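(* Let $N\in\mathbb N$ and fix a vertex $\varkappa$ of $H(N,2)$, with subconstituent algebra $T=T(\varkappa)$. The Hermitian forms on ${\rm Fix}(G)$ and $T$ are related as follows: $$\langle u,v\rangle=\langle\varepsilon(u),\varepsilon(v)\rangle\qquad\text{for all }u,v\in{\rm Fix}(G).$$
   Context: $\mathbb N=\{0,1,2,\ldots\}$; all vector spaces and algebras are over $\mathbb C$, and a subalgebra has the same multiplicative identity as the parent algebra; Hermitian forms are linear in the first argument and conjugate-symmetric. $H(N,2)$ is the graph with vertex set $X=\{1,-1\}^N$, two vertices adjacent when they differ in exactly one coordinate; $\partial$ is path-length distance. $V$ is the vector space with basis $X$. $V^{\otimes 3}=V\otimes V\otimes V$ has basis $X^{\otimes 3}=\{x\otimes y\otimes z:x,y,z\in X\}$ and carries the Hermitian form $\langle\,,\,\rangle$ for which $X^{\otimes 3}$ is orthonormal. $G$ is the automorphism group of the graph, acting linearly on $V$ by permuting $X$ and on $V^{\otimes3}$ by $g(u\otimes v\otimes w)=g(u)\otimes g(v)\otimes g(w)$; ${\rm Fix}(G)=\{v\in V^{\otimes 3}:g(v)=v\ \forall g\in G\}$, with the form restricted from $V^{\otimes 3}$. For $x,y\in X$, $e_{x,y}\in{\rm End}(V)$ sends $y\mapsto x$ and all other vertices to $0$; ${\rm End}(V)$ carries the Hermitian form $\langle\,,\,\rangle$ for which the basis $\{e_{x,y}\}_{x,y\in X}$ is orthonormal. The $\mathbb C$-linear map $\varepsilon:V^{\otimes3}\to{\rm End}(V)$ is given on $X^{\otimes 3}$ by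 $\varepsilon(x\otimes y\otimes z)=2^{N/2}e_{y,z}$ if $x=\varkappa$ and $0$ if $x\neq\varkappa$. The adjacency map ${\sf A}\in{\rm End}(V)$ sends each $x\in X$ to the sum of its neighbours; the dual adjacency map ${\sf A}^*={\sf A}^*(\varkappa)\in{\rm End}(V)$ is given by ${\sf A}^*x=(N-2\partial(x,\varkappa))x$ for $x\in X$. $T=T(\varkappa)$ is the subalgebra of ${\rm End}(V)$ generated by ${\sf A},{\sf A}^*$, with the form restricted from ${\rm End}(V)$. *)

theory Defs
  imports Complex_Main "HOL-Library.FuncSet"
begin

section \<open>Free complex vector spaces on finite sets\<close>

(* The space with basis B is the set of functions supported in B;
   the basis element b is the indicator function of {b}. *)

definition free_space :: "'a set \<Rightarrow> ('a \<Rightarrow> complex) set" where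
  "free_space B = {v. \<forall>b. b \<notin> B \<longrightarrow> v b = 0}"

definition basis_vec :: "'a \<Rightarrow> 'a \<Rightarrow> complex" where
  "basis_vec b = (\<lambda>c. if c = b then 1 else 0)"

definition herm_form :: "'a set \<Rightarrow> ('a \<Rightarrow> complex) \<Rightarrow> ('a \<Rightarrow> complex) \<Rightarrow> complex" where
  "herm_form B u v = (\<Sum>b\<in>B. u b * cnj (v b))"


section \<open>The hypercube\<close>

type_synonym vertex = "nat \<Rightarrow> int"

definition verts :: "nat \<Rightarrow> vertex set" where
  "verts N = {1..N} \<rightarrow>\<^sub>E {1, -1}"

definition adj :: "nat \<Rightarrow> (vertex \<times> vertex) set" where
  "adj N = {(x, y). x \<in> verts N \<and> y \<in> verts N \<and> (\<exists>!i. i \<in> {1..N} \<and> x i \<noteq> y i)}"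

definition path_dist :: "nat \<Rightarrow> vertex \<Rightarrow> vertex \<Rightarrow> nat" where
  "path_dist N x y = (LEAST n. (x, y) \<in> adj N ^^ n)"

definition aut_group :: "nat \<Rightarrow> (vertex \<Rightarrow> vertex) set" where
  "aut_group N = {g \<in> extensional (verts N). bij_betw g (verts N) (verts N) \<and>
     (\<forall>x\<in>verts N. \<forall>y\<in>verts N. (g x, g y) \<in> adj N \<longleftrightarrow> (x, y) \<in> adj N)}"


section \<open>The space \<open>V\<close> and its third tensor power\<close>

definition V :: "nat \<Rightarrow> (vertex \<Rightarrow> complex) set" where
  "V N = free_space (verts N)"

definition triples :: "nat \<Rightarrow> (vertex \<times> vertex \<times> vertex) set" where
  "triples N = verts N \<times> verts N \<times> verts N"

(* The basis element of V3 indexed by (x, y, z) is the tensor product of the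
   vertices x, y, z; see tensor3_basis_vec. *)
definition V3 :: "nat \<Rightarrow> (vertex \<times> vertex \<times> vertex \<Rightarrow> complex) set" where
  "V3 N = free_space (triples N)"

definition tensor3 ::
  "(vertex \<Rightarrow> complex) \<Rightarrow> (vertex \<Rightarrow> complex) \<Rightarrow> (vertex \<Rightarrow> complex) \<Rightarrow>
   vertex \<times> vertex \<times> vertex \<Rightarrow> complex" where
  "tensor3 u v w = (\<lambda>(x, y, z). u x * v y * w z)"

lemma tensor3_basis_vec:
  "tensor3 (basis_vec x) (basis_vec y) (basis_vec z) = basis_vec (x, y, z)"
  by (auto simp: tensor3_def basis_vec_def fun_eq_iff)

definition act_V :: "nat \<Rightarrow> (vertex \<Rightarrow> vertex) \<Rightarrow> (vertex \<Rightarrow> complex) \<Rightarrow> (vertex \<Rightarrow> complex)" where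
  "act_V N g v = (\<lambda>p. \<Sum>x\<in>verts N. v x * basis_vec (g x) p)"

definition act_V3 :: "nat \<Rightarrow> (vertex \<Rightarrow> vertex) \<Rightarrow>
  (vertex \<times> vertex \<times> vertex \<Rightarrow> complex) \<Rightarrow> (vertex \<times> vertex \<times> vertex \<Rightarrow> complex)" where
  "act_V3 N g t = (\<lambda>p. \<Sum>(x, y, z)\<in>triples N. t (x, y, z) *
     tensor3 (act_V N g (basis_vec x)) (act_V N g (basis_vec y)) (act_V N g (basis_vec z)) p)"

definition Fix_G :: "nat \<Rightarrow> (vertex \<times> vertex \<times> vertex \<Rightarrow> complex) set" where
  "Fix_G N = {t \<in> V3 N. \<forall>g\<in>aut_group N. act_V3 N g t = t}"


section \<open>The endomorphism algebra of \<open>V\<close>\<close>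

(* Endomorphisms are functions that are undefined outside V N, so that equality of
   endomorphisms is equality of functions. *)

type_synonym endo = "(vertex \<Rightarrow> complex) \<Rightarrow> (vertex \<Rightarrow> complex)"

definition End_V :: "nat \<Rightarrow> endo set" where
  "End_V N = {a \<in> V N \<rightarrow>\<^sub>E V N.
     (\<forall>u\<in>V N. \<forall>v\<in>V N. a (\<lambda>p. u p + v p) = (\<lambda>p. a u p + a v p)) \<and>
     (\<forall>c. \<forall>v\<in>V N. a (\<lambda>p. c * v p) = (\<lambda>p. c * a v p))}"

definition end_one :: "nat \<Rightarrow> endo" where
  "end_one N = (\<lambda>v\<in>V N. v)"

definition end_zero :: "nat \<Rightarrow> endo" where
  "end_zero N = (\<lambda>v\<in>V N. \<lambda>p. 0)"

definition end_add :: "nat \<Rightarrow> endo \<Rightarrow> endo \<Rightarrow> endo" where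
  "end_add N a b = (\<lambda>v\<in>V N. \<lambda>p. a v p + b v p)"

definition end_scale :: "nat \<Rightarrow> complex \<Rightarrow> endo \<Rightarrow> endo" where
  "end_scale N c a = (\<lambda>v\<in>V N. \<lambda>p. c * a v p)"

definition end_mult :: "nat \<Rightarrow> endo \<Rightarrow> endo \<Rightarrow> endo" where
  "end_mult N a b = compose (V N) a b"

definition lin_ext :: "nat \<Rightarrow> (vertex \<Rightarrow> vertex \<Rightarrow> complex) \<Rightarrow> endo" where
  "lin_ext N f = (\<lambda>v\<in>V N. \<lambda>p. \<Sum>x\<in>verts N. v x * f x p)"

definition mat_unit :: "nat \<Rightarrow> vertex \<Rightarrow> vertex \<Rightarrow> endo" where
  "mat_unit N x y = lin_ext N (\<lambda>z. if z = y then basis_vec x else (\<lambda>p. 0))"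

(* a (basis_vec y) x is the coefficient of a at mat_unit N x y;
   see end_expansion and end_form_mat_unit. *)
definition end_form :: "nat \<Rightarrow> endo \<Rightarrow> endo \<Rightarrow> complex" where
  "end_form N a b =
     (\<Sum>x\<in>verts N. \<Sum>y\<in>verts N. a (basis_vec y) x * cnj (b (basis_vec y) x))"

definition subalgebra_End :: "nat \<Rightarrow> endo set \<Rightarrow> bool" where
  "subalgebra_End N S \<longleftrightarrow> S \<subseteq> End_V N \<and> end_one N \<in> S \<and>
     (\<forall>a\<in>S. \<forall>b\<in>S. end_add N a b \<in> S \<and> end_mult N a b \<in> S) \<and>
     (\<forall>c. \<forall>a\<in>S. end_scale N c a \<in> S)"


section \<open>The subconstituent algebra and the map \<open>\<epsilon>\<close>\<close>

definition adj_map :: "nat \<Rightarrow> endo" where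
  "adj_map N = lin_ext N (\<lambda>x p. \<Sum>y | (x, y) \<in> adj N. basis_vec y p)"

definition dual_adj_map :: "nat \<Rightarrow> vertex \<Rightarrow> endo" where
  "dual_adj_map N \<kappa> =
     lin_ext N (\<lambda>x p. (of_nat N - 2 * of_nat (path_dist N x \<kappa>)) * basis_vec x p)"

definition subconst_alg :: "nat \<Rightarrow> vertex \<Rightarrow> endo set" where
  "subconst_alg N \<kappa> =
     \<Inter>{S. subalgebra_End N S \<and> adj_map N \<in> S \<and> dual_adj_map N \<kappa> \<in> S}"

definition eps_basis :: "nat \<Rightarrow> vertex \<Rightarrow> vertex \<Rightarrow> vertex \<Rightarrow> vertex \<Rightarrow> endo" where
  "eps_basis N \<kappa> x y z =
     (if x = \<kappa> then end_scale N (complex_of_real (2 powr (real N / 2))) (mat_unit N y z)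
      else end_zero N)"

definition eps :: "nat \<Rightarrow> vertex \<Rightarrow> (vertex \<times> vertex \<times> vertex \<Rightarrow> complex) \<Rightarrow> endo" where
  "eps N \<kappa> t = (\<lambda>v\<in>V N. \<lambda>p. \<Sum>(x, y, z)\<in>triples N. t (x, y, z) * eps_basis N \<kappa> x y z v p)"


section \<open>Consistency of the encoding\<close>

lemma finite_verts [simp]: "finite (verts N)"
  by (auto simp: verts_def intro: finite_PiE)

lemma basis_vec_in_V: "x \<in> verts N \<Longrightarrow> basis_vec x \<in> V N"
  by (auto simp: V_def free_space_def basis_vec_def)

lemma mat_unit_apply:
  assumes "v \<in> V N" "y \<in> verts N"
  shows "mat_unit N x y v = (\<lambda>p. v y * basis_vec x p)"
proof
  fix p
  have "mat_unit N x y v p = (\<Sum>w\<in>verts N. if w = y then v y * basis_vec x p else 0)"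
    using assms unfolding mat_unit_def lin_ext_def restrict_apply'[OF assms(1)]
    by (intro sum.cong) simp_all
  then show "mat_unit N x y v p = v y * basis_vec x p"
    using assms by simp
qed

lemma mat_unit_basis_vec:
  assumes "z \<in> verts N" "y \<in> verts N"
  shows "mat_unit N x y (basis_vec z) = (if z = y then basis_vec x else (\<lambda>p. 0))"
  by (simp only: mat_unit_apply[OF basis_vec_in_V[OF assms(1)] assms(2)])
     (auto simp: basis_vec_def)

lemma end_form_mat_unit:
  assumes "x \<in> verts N" "y \<in> verts N" "x' \<in> verts N" "y' \<in> verts N"
  shows "end_form N (mat_unit N x y) (mat_unit N x' y') = (if x = x' \<and> y = y' then 1 else 0)"
proof -
  have mu: "mat_unit N c d (basis_vec b) a = (if b = d \<and> a = c then 1 else 0)"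
    if "b \<in> verts N" "d \<in> verts N" for a b c d
    unfolding mat_unit_basis_vec[OF that] by (simp add: basis_vec_def)
  have "end_form N (mat_unit N x y) (mat_unit N x' y')
      = (\<Sum>a\<in>verts N. \<Sum>b\<in>verts N. if b = y then (if a = x then (if x = x' \<and> y = y' then 1 else 0) else 0) else 0)"
    unfolding end_form_def
    by (intro sum.cong refl) (auto simp: mu assms)
  also have "\<dots> = (if x = x' \<and> y = y' then 1 else 0)"
    using assms by (simp only: sum.delta finite_verts if_True)
  finally show ?thesis .
qed

lemma End_V_sum:
  assumes a: "a \<in> End_V N" and "finite B" "B \<subseteq> verts N"
  shows "a (\<lambda>p. \<Sum>y\<in>B. v y * basis_vec y p) = (\<lambda>p. \<Sum>y\<in>B. v y * a (basis_vec y) p)"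
proof -
  have add: "a (\<lambda>p. u p + w p) = (\<lambda>p. a u p + a w p)" if "u \<in> V N" "w \<in> V N" for u w
    using a that by (simp add: End_V_def)
  have scale: "a (\<lambda>p. c * w p) = (\<lambda>p. c * a w p)" if "w \<in> V N" for c w
    using a that by (simp add: End_V_def)
  show ?thesis
    using assms(2,3)
  proof (induction B rule: finite_induct)
    case empty
    have "(\<lambda>p. 0) \<in> V N" by (simp add: V_def free_space_def)
    from scale[OF this, of 0] show ?case by simp
  next
    case (insert b B)
    let ?u = "\<lambda>p. v b * basis_vec b p" and ?w = "\<lambda>p. \<Sum>y\<in>B. v y * basis_vec y p"
    have b: "basis_vec b \<in> V N" using insert by (auto intro: basis_vec_in_V)
    have uV: "?u \<in> V N" using b by (simp add: V_def free_space_def)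
    have wV: "?w \<in> V N"
      using insert by (auto simp: V_def free_space_def basis_vec_def intro!: sum.neutral)
    have "a (\<lambda>p. ?u p + ?w p) = (\<lambda>p. a ?u p + a ?w p)"
      by (rule add[OF uV wV])
    moreover have "a ?u = (\<lambda>p. v b * a (basis_vec b) p)"
      by (rule scale[OF b])
    ultimately show ?case
      using insert by simp
  qed
qed

lemma end_expansion:
  assumes a: "a \<in> End_V N"
  shows "a = (\<lambda>v\<in>V N. \<lambda>p. \<Sum>x\<in>verts N. \<Sum>y\<in>verts N.
               a (basis_vec y) x * mat_unit N x y v p)"
proof (rule extensionalityI[of _ "V N"])
  show "a \<in> extensional (V N)" using a by (auto simp: End_V_def PiE_def)
  fix v assume v: "v \<in> V N"
  have v_eq: "v = (\<lambda>p. \<Sum>y\<in>verts N. v y * basis_vec y p)"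
  proof
    fix p
    have "(\<Sum>y\<in>verts N. v y * basis_vec y p) = (\<Sum>y\<in>verts N. if y = p then v p else 0)"
      by (intro sum.cong) (auto simp: basis_vec_def)
    then show "v p = (\<Sum>y\<in>verts N. v y * basis_vec y p)"
      using v by (simp add: V_def free_space_def)
  qed
  have inV: "a (basis_vec y) \<in> V N" if "y \<in> verts N" for y
    using a that by (auto simp: End_V_def intro: basis_vec_in_V)
  have av: "a v = (\<lambda>p. \<Sum>y\<in>verts N. v y * a (basis_vec y) p)"
    using End_V_sum[OF a finite_verts subset_refl, of v] v_eq by simp
  have "a v p = (\<Sum>x\<in>verts N. \<Sum>y\<in>verts N. a (basis_vec y) x * mat_unit N x y v p)" for p
  proof -
    have "(\<Sum>x\<in>verts N. \<Sum>y\<in>verts N. a (basis_vec y) x * mat_unit N x y v p)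
        = (\<Sum>y\<in>verts N. \<Sum>x\<in>verts N. if x = p then v y * a (basis_vec y) p else 0)"
      by (subst sum.swap, intro sum.cong refl) (simp add: mat_unit_apply[OF v] basis_vec_def)
    also have "\<dots> = (\<Sum>y\<in>verts N. v y * a (basis_vec y) p)"
      using inV by (intro sum.cong refl) (auto simp: V_def free_space_def)
    finally show ?thesis by (simp add: av)
  qed
  then show "a v = (\<lambda>v\<in>V N. \<lambda>p. \<Sum>x\<in>verts N. \<Sum>y\<in>verts N.
               a (basis_vec y) x * mat_unit N x y v p) v"
    using v by auto
qed auto

end

(* Recording where a vertex differs from \<kappa> turns vertices into subsets of {1..N}. The automorphism
   group is transitive (translations by symmetric difference), so an invariant tensor is determined
   by its slice at \<kappa>, and each of the 2^N slices contributes equally to the form; the factor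
   2^(N/2) compensates for this.

   That slice is invariant under coordinate permutations, so its entry at (Y, Z) depends only on
   |Y|, |Z| and |Y \<inter> Z|. Such matrices lie in T: polynomials in A* give the projections onto
   the levels, which cut the raising operator out of A; its divided powers sum to the inclusion
   matrix; the product of the inclusion matrix, the projection onto level k and the transposed
   inclusion matrix has entries (|Y \<inter> Z| choose k), and binomial inversion isolates each
   value of |Y \<inter> Z|. *)

theory Submission
  imports Defs
begin

section \<open>Kernels on a Boolean lattice\<close>

text \<open>A kernel \<open>f\<close> stands for the matrix with entry \<open>f Y Z\<close> in row
  \<open>Y\<close> and column \<open>Z\<close>, indexed by the subsets of \<open>I\<close>. Axiom
  \<open>cong\<close> makes membership depend only on these entries. The last two axioms supply the
  generators, with the empty set as base vertex.\<close>

locale kernel_algebra =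
  fixes I :: "'a set" and M :: "('a set \<Rightarrow> 'a set \<Rightarrow> complex) set"
  assumes finite_I: "finite I"
    and cong: "\<lbrakk>f \<in> M; \<And>Y Z. \<lbrakk>Y \<subseteq> I; Z \<subseteq> I\<rbrakk> \<Longrightarrow> g Y Z = f Y Z\<rbrakk> \<Longrightarrow> g \<in> M"
    and add: "\<lbrakk>f \<in> M; g \<in> M\<rbrakk> \<Longrightarrow> (\<lambda>Y Z. f Y Z + g Y Z) \<in> M"
    and scale: "f \<in> M \<Longrightarrow> (\<lambda>Y Z. c * f Y Z) \<in> M"
    and mult: "\<lbrakk>f \<in> M; g \<in> M\<rbrakk> \<Longrightarrow> (\<lambda>Y Z. \<Sum>W\<in>Pow I. f Y W * g W Z) \<in> M"
    and one: "(\<lambda>Y Z. of_bool (Y = Z)) \<in> M"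
    and adjacency: "(\<lambda>Y Z. of_bool (card (sym_diff Y Z) = 1)) \<in> M"
    and dual_adjacency:
      "(\<lambda>Y Z. of_bool (Y = Z) * (of_nat (card I) - 2 * of_nat (card Y))) \<in> M"
begin

text \<open>Transposition reverses products and fixes both generators, so the transposed kernels
  satisfy the same axioms. Results about rows thereby transfer to columns without knowing that
  \<open>M\<close> is closed under transposition.\<close>

lemma transpose: "kernel_algebra I {f. (\<lambda>Y Z. f Z Y) \<in> M}"
proof
  show "finite I" by (rule finite_I)
next
  fix f g :: "'a set \<Rightarrow> 'a set \<Rightarrow> complex"
  assume "f \<in> {f. (\<lambda>Y Z. f Z Y) \<in> M}" and "\<And>Y Z. \<lbrakk>Y \<subseteq> I; Z \<subseteq> I\<rbrakk> \<Longrightarrow> g Y Z = f Y Z"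
  then show "g \<in> {f. (\<lambda>Y Z. f Z Y) \<in> M}"
    by (auto intro: cong)
next
  fix f g :: "'a set \<Rightarrow> 'a set \<Rightarrow> complex"
  assume "f \<in> {f. (\<lambda>Y Z. f Z Y) \<in> M}" "g \<in> {f. (\<lambda>Y Z. f Z Y) \<in> M}"
  then have f: "(\<lambda>Y Z. f Z Y) \<in> M" and g: "(\<lambda>Y Z. g Z Y) \<in> M" by simp_all
  show "(\<lambda>Y Z. f Y Z + g Y Z) \<in> {f. (\<lambda>Y Z. f Z Y) \<in> M}"
    using add[OF f g] by simp
  show "(\<lambda>Y Z. \<Sum>W\<in>Pow I. f Y W * g W Z) \<in> {f. (\<lambda>Y Z. f Z Y) \<in> M}"
    using mult[OF g f] by (simp add: mult.commute)
next
  fix f :: "'a set \<Rightarrow> 'a set \<Rightarrow> complex" and c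
  assume "f \<in> {f. (\<lambda>Y Z. f Z Y) \<in> M}"
  then show "(\<lambda>Y Z. c * f Y Z) \<in> {f. (\<lambda>Y Z. f Z Y) \<in> M}"
    using scale by simp
next
  show "(\<lambda>Y Z. of_bool (Y = Z)) \<in> {f. (\<lambda>Y Z. f Z Y) \<in> M}"
    using one by (simp add: eq_commute)
  show "(\<lambda>Y Z. of_bool (card (sym_diff Y Z) = 1)) \<in> {f. (\<lambda>Y Z. f Z Y) \<in> M}"
    using adjacency by (simp add: Un_commute)
  have "(\<lambda>Y Z. of_bool (Z = Y) * (of_nat (card I) - 2 * of_nat (card Z))) \<in> M"
    by (rule cong[OF dual_adjacency]) auto
  then show "(\<lambda>Y Z. of_bool (Y = Z) * (of_nat (card I) - 2 * of_nat (card Y)))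
      \<in> {f. (\<lambda>Y Z. f Z Y) \<in> M}"
    by simp
qed

lemma sum_mem:
  assumes "finite J" "\<And>j. j \<in> J \<Longrightarrow> f j \<in> M"
  shows "(\<lambda>Y Z. \<Sum>j\<in>J. f j Y Z) \<in> M"
  using assms
proof (induction J rule: finite_induct)
  case empty
  show ?case using scale[OF one, of 0] by simp
next
  case (insert j J)
  then show ?case using add[of "f j" "\<lambda>Y Z. \<Sum>j\<in>J. f j Y Z"] by simp
qed

section \<open>Diagonal kernels and weights depending on levels\<close>

lemma finite_if_subset: "Y \<subseteq> I \<Longrightarrow> finite Y"
  using finite_I by (rule finite_subset[rotated])

lemma card_le: "Y \<subseteq> I \<Longrightarrow> card Y \<le> card I"
  using finite_I by (rule card_mono)

lemma diag_affine: "(\<lambda>Y Z. of_bool (Y = Z) * (a * of_nat (card Y) + b)) \<in> M"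
proof -
  have "(\<lambda>Y Z. (- a / 2) * (of_bool (Y = Z) * (of_nat (card I) - 2 * of_nat (card Y)))
      + (a * of_nat (card I) / 2 + b) * of_bool (Y = Z)) \<in> M"
    by (intro add scale one dual_adjacency)
  then show ?thesis
    by (rule cong) (simp add: algebra_simps)
qed

lemma diag_mult:
  assumes "(\<lambda>Y Z. of_bool (Y = Z) * h (card Y)) \<in> M" "f \<in> M"
  shows "(\<lambda>Y Z. h (card Y) * f Y Z) \<in> M"
proof (rule cong[OF mult[OF assms]])
  fix Y Z assume "Y \<subseteq> I" "Z \<subseteq> I"
  have "(\<Sum>W\<in>Pow I. of_bool (Y = W) * h (card Y) * f W Z)
      = (\<Sum>W\<in>Pow I. if Y = W then h (card Y) * f Y Z else 0)"
    by (intro sum.cong) auto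
  also have "\<dots> = h (card Y) * f Y Z"
    using finite_I \<open>Y \<subseteq> I\<close> by (simp add: sum.delta')
  finally show "h (card Y) * f Y Z
      = (\<Sum>W\<in>Pow I. of_bool (Y = W) * h (card Y) * f W Z)" ..
qed

text \<open>Products of affine functions of the level suffice for the Lagrange basis polynomials
  used in \<open>diag\<close>.\<close>

lemma diag_prod:
  assumes "finite J"
  shows "(\<lambda>Y Z. of_bool (Y = Z) * (\<Prod>j\<in>J. a j * of_nat (card Y) + b j)) \<in> M"
  using assms
proof (induction J rule: finite_induct)
  case empty
  show ?case using one by simp
next
  case (insert j J)
  from diag_mult[OF diag_affine[of "a j" "b j"] insert.IH]
  show ?case using insert by (simp add: mult_ac)
qed

text \<open>Lagrange interpolation at the distinct eigenvalues of the dual adjacency kernel.\<close>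

lemma diag: "(\<lambda>Y Z. of_bool (Y = Z) * h (card Y)) \<in> M"
proof -
  define n where "n = card I"
  \<comment> \<open>The Lagrange basis polynomial of node \<open>k\<close> among 0, ..., n; each
    factor (x - j)/(k - j) is written in the affine shape that \<open>diag_prod\<close>
    accepts.\<close>
  define q where "q k x = (\<Prod>j\<in>{..n} - {k}.
      (1 / (of_nat k - of_nat j)) * of_nat x + - of_nat j / (of_nat k - of_nat j) :: complex)"
    for k x :: nat
  have q: "q k x = of_bool (x = k)" if "k \<le> n" "x \<le> n" for k x
  proof (cases "x = k")
    case True
    have "q k x = (\<Prod>j\<in>{..n} - {k}. 1)"
      unfolding q_def True by (intro prod.cong) (auto simp: diff_divide_distrib[symmetric])
    with True show ?thesis by simp
  next
    case False
    have "q k x = 0"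
      unfolding q_def using False that by (intro prod_zero bexI[of _ x]) (auto simp: field_simps)
    with False show ?thesis by simp
  qed
  have "(\<lambda>Y Z. \<Sum>k\<le>n. h k * (of_bool (Y = Z) * q k (card Y))) \<in> M"
    unfolding q_def by (intro sum_mem scale diag_prod) auto
  then show ?thesis
  proof (rule cong)
    fix Y Z assume "Y \<subseteq> I" "Z \<subseteq> I"
    then have le: "card Y \<le> n" by (simp add: n_def card_le)
    have "(\<Sum>k\<le>n. h k * (of_bool (Y = Z) * q k (card Y)))
        = (\<Sum>k\<le>n. if card Y = k then of_bool (Y = Z) * h (card Y) else 0)"
      using le by (intro sum.cong) (auto simp: q)
    also have "\<dots> = of_bool (Y = Z) * h (card Y)"
      using le by (simp add: sum.delta')
    finally show "of_bool (Y = Z) * h (card Y)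
        = (\<Sum>k\<le>n. h k * (of_bool (Y = Z) * q k (card Y)))" ..
  qed
qed

lemma weight_left: "f \<in> M \<Longrightarrow> (\<lambda>Y Z. h (card Y) * f Y Z) \<in> M"
  by (rule diag_mult[OF diag])

lemma weight_right:
  assumes "f \<in> M"
  shows "(\<lambda>Y Z. h (card Z) * f Y Z) \<in> M"
proof -
  interpret t: kernel_algebra I "{f. (\<lambda>Y Z. f Z Y) \<in> M}" by (rule transpose)
  show ?thesis using t.weight_left[of "\<lambda>Y Z. f Z Y" h] assms by simp
qed

text \<open>A weight in two levels need not factor. Splitting by the value \<open>j\<close> of
  \<open>card Z\<close> writes it as a sum of left weights times right weights.\<close>

lemma weight:
  assumes "f \<in> M"
  shows "(\<lambda>Y Z. h (card Y) (card Z) * f Y Z) \<in> M"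
proof -
  have "(\<lambda>Y Z. \<Sum>j\<le>card I. h (card Y) j * (of_bool (card Z = j) * f Y Z)) \<in> M"
    by (intro sum_mem weight_left[where h = "\<lambda>n. h n _"]
        weight_right[where h = "\<lambda>n. of_bool (n = _)"] assms) auto
  then show ?thesis
  proof (rule cong)
    fix Y Z assume "Y \<subseteq> I" "Z \<subseteq> I"
    have "(\<Sum>j\<le>card I. h (card Y) j * (of_bool (card Z = j) * f Y Z))
        = (\<Sum>j\<le>card I. if card Z = j then h (card Y) (card Z) * f Y Z else 0)"
      by (intro sum.cong) auto
    also have "\<dots> = h (card Y) (card Z) * f Y Z"
      using card_le[OF \<open>Z \<subseteq> I\<close>] by (simp add: sum.delta')
    finally show "h (card Y) (card Z) * f Y Z
        = (\<Sum>j\<le>card I. h (card Y) j * (of_bool (card Z = j) * f Y Z))" ..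
  qed
qed

section \<open>The raising operator and the inclusion matrix\<close>

text \<open>Adjacent subsets differ in one element, so restricting the adjacency kernel to pairs
  whose levels go up by one leaves exactly the covering pairs.\<close>

lemma raising: "(\<lambda>Y Z. of_bool (Z \<subseteq> Y \<and> card Y = card Z + 1)) \<in> M"
proof (rule cong[OF weight[OF adjacency, of "\<lambda>m n. of_bool (m = n + 1)"]])
  fix Y Z assume YZ: "Y \<subseteq> I" "Z \<subseteq> I"
  then have fin: "finite Y" "finite Z" by (simp_all add: finite_if_subset)
  have "Z \<subseteq> Y \<longleftrightarrow> card (sym_diff Y Z) = 1" if c: "card Y = card Z + 1"
  proof
    assume "Z \<subseteq> Y"
    then have "sym_diff Y Z = Y - Z" by auto
    with \<open>Z \<subseteq> Y\<close> c fin show "card (sym_diff Y Z) = 1" by (simp add: card_Diff_subset)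
  next
    assume "card (sym_diff Y Z) = 1"
    \<comment> \<open>The two one-sided differences have sizes with sum 1, and by \<open>c\<close>
      their sizes also differ by 1 in favour of \<open>Y - Z\<close>; hence \<open>Z - Y\<close> is
      empty.\<close>
    then have s: "card (Y - Z) + card (Z - Y) = 1"
      using fin by (subst (asm) card_Un_disjoint) auto
    have "card Y = card (Y \<inter> Z) + card (Y - Z)" "card Z = card (Y \<inter> Z) + card (Z - Y)"
      using fin card_Int_Diff[of Y Z] card_Int_Diff[of Z Y] by (auto simp: Int_commute)
    with c s have "card (Z - Y) = 0" by simp
    with fin show "Z \<subseteq> Y" by simp
  qed
  then show "of_bool (Z \<subseteq> Y \<and> card Y = card Z + 1)
      = of_bool (card Y = card Z + 1) * (of_bool (card (sym_diff Y Z) = 1) :: complex)"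
    by (cases "card Y = card Z + 1") simp_all
qed

text \<open>The intermediate sets arise by deleting one element of \<open>Y - Z\<close> from
  \<open>Y\<close>. The count is the factor by which the raising operator times its n-th divided
  power exceeds the next divided power.\<close>

lemma card_between:
  assumes "Y \<subseteq> I" "Z \<subseteq> I"
  shows "card {W \<in> Pow I. (W \<subseteq> Y \<and> card Y = card W + 1) \<and> Z \<subseteq> W \<and> card W = card Z + n}
    = (if Z \<subseteq> Y \<and> card Y = card Z + Suc n then Suc n else 0)"
    (is "card ?S = _")
proof (cases "Z \<subseteq> Y \<and> card Y = card Z + Suc n")
  case True
  have finY: "finite Y" using assms by (simp add: finite_if_subset)
  have "?S = (\<lambda>i. Y - {i}) ` (Y - Z)"
  proof (intro equalityI subsetI)
    fix W assume W: "W \<in> ?S"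
    then have "card (Y - W) = 1"
      using finY by (auto simp: card_Diff_subset finite_subset)
    then obtain i where "Y - W = {i}" by (auto simp: card_1_singleton_iff)
    with W have "W = Y - {i}" "i \<in> Y - Z" by auto
    then show "W \<in> (\<lambda>i. Y - {i}) ` (Y - Z)" by auto
  next
    fix W assume "W \<in> (\<lambda>i. Y - {i}) ` (Y - Z)"
    then show "W \<in> ?S" using True assms finY by auto
  qed
  moreover have "inj_on (\<lambda>i. Y - {i}) (Y - Z)" by (auto simp: inj_on_def)
  ultimately have "card ?S = card (Y - Z)" by (simp only: card_image)
  also have "card (Y - Z) = Suc n"
    using True finY card_Diff_subset[of Z Y] by (auto dest: finite_subset)
  finally show ?thesis unfolding if_P[OF True] .
next
  case False
  then have "?S = {}" by auto
  with False show ?thesis by (metis card.empty)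
qed

text \<open>This kernel is the n-th divided power R^n / n! of the raising operator R; by
  \<open>card_between\<close>, each further multiplication by R is followed by division by
  \<open>Suc n\<close>.\<close>

lemma raising_power: "(\<lambda>Y Z. of_bool (Z \<subseteq> Y \<and> card Y = card Z + n)) \<in> M"
proof (induction n)
  case 0
  show ?case
  proof (rule cong[OF one])
    fix Y Z assume "Y \<subseteq> I" "Z \<subseteq> I"
    then have "finite Y" by (simp add: finite_if_subset)
    then show "of_bool (Z \<subseteq> Y \<and> card Y = card Z + 0) = (of_bool (Y = Z) :: complex)"
      using card_subset_eq[of Y Z] by auto
  qed
next
  case (Suc n)
  show ?case
  proof (rule cong[OF scale[OF mult[OF raising Suc], of "1 / of_nat (Suc n)"]])
    fix Y Z assume YZ: "Y \<subseteq> I" "Z \<subseteq> I"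
    have "(\<Sum>W\<in>Pow I. of_bool (W \<subseteq> Y \<and> card Y = card W + 1)
          * of_bool (Z \<subseteq> W \<and> card W = card Z + n))
        = (of_nat (card {W \<in> Pow I. (W \<subseteq> Y \<and> card Y = card W + 1)
            \<and> Z \<subseteq> W \<and> card W = card Z + n}) :: complex)"
      using finite_I
      by (simp only: of_bool_conj[symmetric] sum_of_bool_eq finite_Pow_iff)
         (simp add: Int_def)
    also have "\<dots> = (if Z \<subseteq> Y \<and> card Y = card Z + Suc n then of_nat (Suc n) else 0)"
      by (simp only: card_between[OF YZ]) simp
    finally show "of_bool (Z \<subseteq> Y \<and> card Y = card Z + Suc n)
        = 1 / complex_of_nat (Suc n) * (\<Sum>W\<in>Pow I. of_bool (W \<subseteq> Y \<and> card Y = card W + 1)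
          * of_bool (Z \<subseteq> W \<and> card W = card Z + n))"
      by (simp del: of_nat_Suc)
  qed
qed

text \<open>The inclusion matrix is the exponential of the raising operator: among the divided
  powers only the one with n = |Y| - |Z| contributes.\<close>

lemma superset: "(\<lambda>Y Z. of_bool (Z \<subseteq> Y)) \<in> M"
proof (rule cong[OF sum_mem[OF finite_atMost raising_power]])
  fix Y Z assume "Y \<subseteq> I" "Z \<subseteq> I"
  \<comment> \<open>Truncated subtraction is harmless here: if \<open>Z\<close> is not contained in
    \<open>Y\<close>, both sides are 0.\<close>
  have "of_bool (Z \<subseteq> Y \<and> card Y = card Z + n)
      = (if card Y - card Z = n then of_bool (Z \<subseteq> Y) else 0 :: complex)" for n
    using card_mono[OF finite_if_subset[OF \<open>Y \<subseteq> I\<close>], of Z] by auto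
  moreover have "card Y - card Z \<le> card I"
    using card_le[OF \<open>Y \<subseteq> I\<close>] by simp
  ultimately show "of_bool (Z \<subseteq> Y)
      = (\<Sum>n\<le>card I. of_bool (Z \<subseteq> Y \<and> card Y = card Z + n) :: complex)"
    by (simp add: sum.delta')
qed

lemma subset: "(\<lambda>Y Z. of_bool (Y \<subseteq> Z)) \<in> M"
proof -
  interpret t: kernel_algebra I "{f. (\<lambda>Y Z. f Z Y) \<in> M}" by (rule transpose)
  show ?thesis using t.superset by simp
qed

text \<open>Inserting the projection onto level \<open>k\<close> between the two inclusion matrices
  counts the common \<open>k\<close>-subsets of \<open>Y\<close> and \<open>Z\<close>.\<close>

lemma binomial_Int: "(\<lambda>Y Z. of_nat (card (Y \<inter> Z) choose k)) \<in> M"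
proof (rule cong[OF mult[OF superset weight_left[OF subset, of "\<lambda>n. of_bool (n = k)"]]])
  fix Y Z assume YZ: "Y \<subseteq> I" "Z \<subseteq> I"
  have fin: "finite (Y \<inter> Z)" using YZ by (auto intro: finite_if_subset)
  have "(\<Sum>W\<in>Pow I. of_bool (W \<subseteq> Y) * (of_bool (card W = k) * of_bool (W \<subseteq> Z)))
      = (of_nat (card {W \<in> Pow I. W \<subseteq> Y \<and> card W = k \<and> W \<subseteq> Z}) :: complex)"
    using finite_I
    by (simp only: of_bool_conj[symmetric] sum_of_bool_eq finite_Pow_iff) (simp add: Int_def)
  also have "{W \<in> Pow I. W \<subseteq> Y \<and> card W = k \<and> W \<subseteq> Z} = {W. W \<subseteq> Y \<inter> Z \<and> card W = k}"
    using YZ by auto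
  also have "card \<dots> = card (Y \<inter> Z) choose k"
    by (rule n_subsets[OF fin])
  finally show "of_nat (card (Y \<inter> Z) choose k)
      = (\<Sum>W\<in>Pow I. of_bool (W \<subseteq> Y) * (of_bool (card W = k) * of_bool (W \<subseteq> Z)) :: complex)" ..
qed

end

section \<open>From binomial kernels to all functions of the three cardinalities\<close>

text \<open>The identity (m choose k)(k choose l) = (m choose l)(m - l choose k - l) reduces the sum
  to an alternating row sum of binomial coefficients, which vanishes unless m = l. The bound
  \<open>n\<close> is independent of \<open>m\<close>, so the same coefficients serve all entries of
  a kernel; the exponent \<open>k + l\<close> has the parity of k - l without truncation.\<close>

lemma binomial_inversion_delta:
  assumes "m \<le> n"
  shows "(\<Sum>k\<le>n. (-1) ^ (k + l) * of_nat (k choose l) * of_nat (m choose k))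
    = (of_bool (m = l) :: complex)"
proof (cases "l \<le> m")
  case False
  then have "(k choose l = 0) \<or> (m choose k = 0)" for k
    by (cases "k < l") auto
  then have "(\<Sum>k\<le>n. (-1) ^ (k + l) * of_nat (k choose l) * of_nat (m choose k)) = (0 :: complex)"
    by (intro sum.neutral) auto
  with False show ?thesis by simp
next
  case True
  have "(\<Sum>k\<le>n. (-1) ^ (k + l) * of_nat (k choose l) * of_nat (m choose k))
      = (\<Sum>k\<in>{l..m}. (-1) ^ (k + l) * of_nat (k choose l) * of_nat (m choose k) :: complex)"
    using assms by (intro sum.mono_neutral_right) auto
  also have "\<dots> = (\<Sum>i\<le>m - l. (-1) ^ i * of_nat (m choose l) * of_nat ((m - l) choose i))"
  proof (rule sum.reindex_bij_witness[of _ "\<lambda>i. i + l" "\<lambda>k. k - l"])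
    fix k assume k: "k \<in> {l..m}"
    have "(m choose k) * (k choose l) = (m choose l) * ((m - l) choose (k - l))"
      using k by (intro choose_mult) auto
    then have "of_nat (m choose k) * of_nat (k choose l)
        = (of_nat (m choose l) * of_nat ((m - l) choose (k - l)) :: complex)"
      by (metis of_nat_mult)
    moreover have "(-1) ^ (k - l) = ((-1) ^ (k + l) :: complex)"
      using k by (simp add: minus_one_power_iff)
    ultimately show "(-1) ^ (k - l) * of_nat (m choose l) * of_nat ((m - l) choose (k - l))
        = (-1) ^ (k + l) * of_nat (k choose l) * (of_nat (m choose k) :: complex)"
      by (simp add: mult_ac)
  qed (use True in auto)
  also have "\<dots> = of_nat (m choose l) * (\<Sum>i\<le>m - l. (-1) ^ i * of_nat ((m - l) choose i))"
    by (simp add: sum_distrib_left mult_ac)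
  also have "\<dots> = of_bool (m = l)"
    using True choose_alternating_sum[of "m - l", where 'a = complex]
    by (cases "m = l") auto
  finally show ?thesis .
qed

lemma (in kernel_algebra) function_of_cards:
  "(\<lambda>Y Z. h (card Y) (card Z) (card (Y \<inter> Z))) \<in> M"
proof -
  define n where "n = card I"
  have ind: "(\<lambda>Y Z. of_bool (card (Y \<inter> Z) = l)) \<in> M" for l
  proof (rule cong[OF sum_mem[OF finite_atMost scale[OF binomial_Int]]])
    fix Y Z assume "Y \<subseteq> I" "Z \<subseteq> I"
    then have "card (Y \<inter> Z) \<le> n"
      unfolding n_def by (intro card_le) auto
    from binomial_inversion_delta[OF this, of l]
    show "of_bool (card (Y \<inter> Z) = l) = (\<Sum>k\<le>n. ((-1) ^ (k + l) * of_nat (k choose l))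
        * of_nat (card (Y \<inter> Z) choose k) :: complex)"
      by simp
  qed
  show ?thesis
  proof (rule cong[OF sum_mem[OF finite_atMost weight[OF ind, of "\<lambda>i j. h i j _"]]])
    fix Y Z assume "Y \<subseteq> I" "Z \<subseteq> I"
    then have "card (Y \<inter> Z) \<le> n"
      unfolding n_def by (intro card_le) auto
    have "(\<Sum>l\<le>n. h (card Y) (card Z) l * of_bool (card (Y \<inter> Z) = l))
        = (\<Sum>l\<le>n. if card (Y \<inter> Z) = l then h (card Y) (card Z) (card (Y \<inter> Z)) else 0)"
      by (intro sum.cong) auto
    also have "\<dots> = h (card Y) (card Z) (card (Y \<inter> Z))"
      using \<open>card (Y \<inter> Z) \<le> n\<close> by (simp add: sum.delta')
    finally show "h (card Y) (card Z) (card (Y \<inter> Z))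
        = (\<Sum>l\<le>n. h (card Y) (card Z) l * of_bool (card (Y \<inter> Z) = l))" ..
  qed
qed

text \<open>Such a kernel factors through the three cardinalities, so
  \<open>function_of_cards\<close> applies.\<close>

lemma (in kernel_algebra) mem_if_cards_invariant:
  assumes inv: "\<And>Y Z Y' Z'. \<lbrakk>Y \<subseteq> I; Z \<subseteq> I; Y' \<subseteq> I; Z' \<subseteq> I;
    card Y = card Y'; card Z = card Z'; card (Y \<inter> Z) = card (Y' \<inter> Z')\<rbrakk> \<Longrightarrow> f Y Z = f Y' Z'"
  shows "f \<in> M"
proof -
  define P where "P i j k q \<longleftrightarrow> fst q \<subseteq> I \<and> snd q \<subseteq> I \<and> card (fst q) = i
      \<and> card (snd q) = j \<and> card (fst q \<inter> snd q) = k" for i j k and q :: "'a set \<times> 'a set"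
  \<comment> \<open>The value is read off at a chosen pair with the given cardinalities; triples
    attained by no pair get an arbitrary value that never enters.\<close>
  define h where "h i j k = (let q = SOME q. P i j k q in f (fst q) (snd q))" for i j k
  show ?thesis
  proof (rule cong[OF function_of_cards[of h]])
    fix Y Z assume YZ: "Y \<subseteq> I" "Z \<subseteq> I"
    define q where "q = (SOME q. P (card Y) (card Z) (card (Y \<inter> Z)) q)"
    have "P (card Y) (card Z) (card (Y \<inter> Z)) (Y, Z)" using YZ by (simp add: P_def)
    then have "P (card Y) (card Z) (card (Y \<inter> Z)) q" unfolding q_def by (rule someI)
    then have "f Y Z = f (fst q) (snd q)"
      using YZ by (intro inv) (simp_all add: P_def)
    then show "f Y Z = h (card Y) (card Z) (card (Y \<inter> Z))"
      by (simp add: h_def Let_def q_def)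
  qed
qed

text \<open>The sets cut \<open>I\<close> into four blocks whose sizes are determined by the given
  cardinalities, and bijections between corresponding blocks glue together.\<close>

lemma ex_bij_betw_two_subsets:
  assumes fin: "finite I" and sub: "Y \<subseteq> I" "Z \<subseteq> I" "Y' \<subseteq> I" "Z' \<subseteq> I"
    and cards: "card Y = card Y'" "card Z = card Z'" "card (Y \<inter> Z) = card (Y' \<inter> Z')"
  shows "\<exists>\<pi>. bij_betw \<pi> I I \<and> \<pi> ` Y = Y' \<and> \<pi> ` Z = Z'"
proof -
  have finite_sub: "finite A" if "A \<subseteq> I" for A using fin that finite_subset by auto
  note f = sub[THEN finite_sub]
  have YZ: "card (Y - Z) = card (Y' - Z')"
    using cards f by (simp add: card_Diff_subset_Int Int_commute)
  have ZY: "card (Z - Y) = card (Z' - Y')"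
    using cards f by (simp add: card_Diff_subset_Int Int_commute)
  have Un: "card (Y \<union> Z) = card (Y' \<union> Z')"
    using cards f card_Un_Int[of Y Z] card_Un_Int[of Y' Z'] by simp
  have co: "card (I - (Y \<union> Z)) = card (I - (Y' \<union> Z'))"
    using Un f sub by (simp add: card_Diff_subset)
  obtain a where a: "bij_betw a (Y \<inter> Z) (Y' \<inter> Z')"
    using f cards finite_same_card_bij[of "Y \<inter> Z" "Y' \<inter> Z'"] by auto
  obtain b where b: "bij_betw b (Y - Z) (Y' - Z')"
    using f YZ finite_same_card_bij[of "Y - Z" "Y' - Z'"] by auto
  obtain c where c: "bij_betw c (Z - Y) (Z' - Y')"
    using f ZY finite_same_card_bij[of "Z - Y" "Z' - Y'"] by auto
  obtain d where d: "bij_betw d (I - (Y \<union> Z)) (I - (Y' \<union> Z'))"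
    using fin co finite_same_card_bij[of "I - (Y \<union> Z)" "I - (Y' \<union> Z')"] by auto
  define \<pi> where "\<pi> i = (if i \<in> Y then if i \<in> Z then a i else b i
      else if i \<in> Z then c i else d i)" for i
  have \<pi>: "bij_betw \<pi> (Y \<inter> Z) (Y' \<inter> Z')" "bij_betw \<pi> (Y - Z) (Y' - Z')"
    "bij_betw \<pi> (Z - Y) (Z' - Y')" "bij_betw \<pi> (I - (Y \<union> Z)) (I - (Y' \<union> Z'))"
    by (rule bij_betw_cong[THEN iffD1, OF _ a] bij_betw_cong[THEN iffD1, OF _ b]
        bij_betw_cong[THEN iffD1, OF _ c] bij_betw_cong[THEN iffD1, OF _ d], simp add: \<pi>_def)+
  have "bij_betw \<pi> ((Y \<inter> Z) \<union> (Y - Z)) ((Y' \<inter> Z') \<union> (Y' - Z'))"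
    by (intro bij_betw_combine \<pi>) auto
  then have Y: "bij_betw \<pi> Y Y'" by (simp add: Int_Diff_Un)
  have "bij_betw \<pi> ((Y \<inter> Z) \<union> (Z - Y)) ((Y' \<inter> Z') \<union> (Z' - Y'))"
    by (intro bij_betw_combine \<pi>) auto
  then have Z: "bij_betw \<pi> Z Z'" by (metis Int_Diff_Un Int_commute)
  have "bij_betw \<pi> ((Y \<union> (Z - Y)) \<union> (I - (Y \<union> Z))) ((Y' \<union> (Z' - Y')) \<union> (I - (Y' \<union> Z')))"
    by (intro bij_betw_combine \<pi> Y) auto
  moreover have "(Y \<union> (Z - Y)) \<union> (I - (Y \<union> Z)) = I" "(Y' \<union> (Z' - Y')) \<union> (I - (Y' \<union> Z')) = I"
    using sub by auto
  ultimately show ?thesis using Y Z by (metis bij_betw_imp_surj_on)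
qed

section \<open>The hypercube as a Boolean lattice\<close>

definition diff_set :: "nat \<Rightarrow> vertex \<Rightarrow> vertex \<Rightarrow> nat set" where
  "diff_set N x y = {i \<in> {1..N}. y i \<noteq> x i}"

lemma finite_diff_set [simp]: "finite (diff_set N x y)"
  by (simp add: diff_set_def)

lemma diff_set_subset: "diff_set N x y \<subseteq> {1..N}"
  by (auto simp: diff_set_def)

lemma verts_cases: "x \<in> verts N \<Longrightarrow> i \<in> {1..N} \<Longrightarrow> x i = 1 \<or> x i = -1"
  by (auto simp: verts_def PiE_def Pi_def)

lemma verts_eqI:
  assumes "x \<in> verts N" "y \<in> verts N" "\<And>i. i \<in> {1..N} \<Longrightarrow> x i = y i"
  shows "x = y"
  using assms unfolding verts_def by (metis PiE_ext)

lemma adj_iff_card_diff_set: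
  assumes "x \<in> verts N" "y \<in> verts N"
  shows "(x, y) \<in> adj N \<longleftrightarrow> card (diff_set N x y) = 1"
proof -
  have "card (diff_set N x y) = 1 \<longleftrightarrow> (\<exists>!i. i \<in> diff_set N x y)"
    by (auto simp: card_1_singleton_iff)
  then show ?thesis
    using assms by (auto simp: adj_def diff_set_def)
qed

text \<open>The triangle inequality for Hamming distance: each step of a walk changes one
  coordinate.\<close>

lemma card_diff_set_le_relpow:
  assumes "(x, y) \<in> adj N ^^ n"
  shows "card (diff_set N x y) \<le> n"
  using assms
proof (induction n arbitrary: y)
  case 0
  then show ?case by (simp add: diff_set_def)
next
  case (Suc n)
  then obtain z where z: "(x, z) \<in> adj N ^^ n" "(z, y) \<in> adj N" by auto
  then have "card (diff_set N z y) = 1"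
    by (subst adj_iff_card_diff_set[symmetric]) (auto simp: adj_def)
  moreover have "card (diff_set N x y) \<le> card (diff_set N x z \<union> diff_set N z y)"
    by (intro card_mono) (auto simp: diff_set_def)
  moreover have "\<dots> \<le> card (diff_set N x z) + card (diff_set N z y)"
    by (rule card_Un_le)
  ultimately show ?case using Suc.IH[OF z(1)] by simp
qed

lemma relpow_card_diff_set:
  assumes "x \<in> verts N" "y \<in> verts N"
  shows "(x, y) \<in> adj N ^^ card (diff_set N x y)"
  using assms(1)
proof (induction "card (diff_set N x y)" arbitrary: x)
  case 0
  then have "diff_set N x y = {}" by (metis card_0_eq finite_diff_set)
  then have "x = y"
    using 0 assms(2) by (intro verts_eqI) (auto simp: diff_set_def)
  with 0 show ?case by simp
next
  case (Suc n)
  then obtain i where i: "i \<in> diff_set N x y" by (metis card.empty ex_in_conv nat.distinct(1))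
  \<comment> \<open>Correcting one wrong coordinate moves to a neighbour of \<open>x\<close> one
    step closer to \<open>y\<close>.\<close>
  define x' where "x' = x(i := y i)"
  have x': "x' \<in> verts N"
    using Suc.prems assms(2) i unfolding x'_def verts_def diff_set_def
    by (auto simp: PiE_def Pi_def extensional_def)
  have "diff_set N x' y = diff_set N x y - {i}"
    by (auto simp: diff_set_def x'_def)
  then have n: "n = card (diff_set N x' y)" using i Suc.hyps(2) by simp
  have "diff_set N x x' = {i}" using i by (auto simp: diff_set_def x'_def)
  then have "(x, x') \<in> adj N" using adj_iff_card_diff_set[OF Suc.prems x'] by simp
  moreover from Suc.hyps(1)[OF n x'] have "(x', y) \<in> adj N ^^ n" using n by simp
  ultimately show ?case using Suc.hyps(2) by (metis relpow_Suc_I2)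
qed

lemma path_dist_eq_card:
  assumes "x \<in> verts N" "y \<in> verts N"
  shows "path_dist N x y = card (diff_set N x y)"
  unfolding path_dist_def
  by (intro Least_equality relpow_card_diff_set card_diff_set_le_relpow assms)

lemma lin_ext_cong:
  assumes "\<And>x p. x \<in> verts N \<Longrightarrow> f x p = g x p"
  shows "lin_ext N f = lin_ext N g"
  unfolding lin_ext_def using assms by (intro restrict_ext ext sum.cong) auto

section \<open>Vertices as subsets relative to the base vertex\<close>

locale based_hypercube =
  fixes N :: nat and \<kappa> :: vertex
  assumes base: "\<kappa> \<in> verts N"
begin

definition "D = diff_set N \<kappa>"

text \<open>The inverse of \<open>D\<close> on vertices; the empty set corresponds to the base
  vertex.\<close>

definition W :: "nat set \<Rightarrow> vertex" where
  "W Y = (\<lambda>i\<in>{1..N}. if i \<in> Y then - \<kappa> i else \<kappa> i)"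

lemma D_subset: "D x \<subseteq> {1..N}"
  unfolding D_def by (rule diff_set_subset)

lemma W_in_verts: "W Y \<in> verts N"
  using verts_cases[OF base] unfolding W_def verts_def
  by (intro restrict_PiE_iff[THEN iffD2] ballI) force

lemma W_D:
  assumes "x \<in> verts N"
  shows "W (D x) = x"
proof (rule verts_eqI[OF W_in_verts assms])
  fix i assume "i \<in> {1..N}"
  then show "W (D x) i = x i"
    using verts_cases[OF base, of i] verts_cases[OF assms, of i]
    by (auto simp: W_def D_def diff_set_def)
qed

lemma D_W:
  assumes "Y \<subseteq> {1..N}"
  shows "D (W Y) = Y"
proof -
  have "- \<kappa> i \<noteq> \<kappa> i" if "i \<in> {1..N}" for i
    using verts_cases[OF base that] by auto
  with assms show ?thesis by (auto simp: W_def D_def diff_set_def)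
qed

lemma W_empty: "W {} = \<kappa>"
  using W_D[OF base] by (simp add: D_def diff_set_def)

lemma bij_D: "bij_betw D (verts N) (Pow {1..N})"
  by (rule bij_betw_byWitness[where f' = W]) (auto simp: W_D D_W W_in_verts dest: subsetD[OF D_subset])

lemma bij_W: "bij_betw W (Pow {1..N}) (verts N)"
  by (rule bij_betw_byWitness[where f' = D]) (auto simp: W_D D_W W_in_verts dest: subsetD[OF D_subset])

text \<open>Coordinates take only two values, so \<open>x\<close> and \<open>y\<close> differ at a
  place exactly when one of them, but not both, differs from \<kappa> there.\<close>

lemma sym_diff_D:
  assumes "x \<in> verts N" "y \<in> verts N"
  shows "sym_diff (D x) (D y) = diff_set N x y"
proof -
  have "(i \<in> sym_diff (D x) (D y)) = (i \<in> diff_set N x y)" for i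
    using verts_cases[OF base, of i] verts_cases[OF assms(1), of i] verts_cases[OF assms(2), of i]
    by (auto simp: D_def diff_set_def)
  then show ?thesis by blast
qed

lemma adj_iff:
  assumes "x \<in> verts N" "y \<in> verts N"
  shows "(x, y) \<in> adj N \<longleftrightarrow> card (sym_diff (D x) (D y)) = 1"
  by (simp only: sym_diff_D[OF assms] adj_iff_card_diff_set[OF assms])

lemma D_eq_iff: "x \<in> verts N \<Longrightarrow> y \<in> verts N \<Longrightarrow> D x = D y \<longleftrightarrow> x = y"
  using bij_D by (auto simp: bij_betw_def inj_on_def)

section \<open>Endomorphisms given by kernels\<close>

text \<open>The output vertex indexes the row and the input vertex the column, so that composition
  becomes the matrix product. The guard on \<open>p\<close> keeps values supported on the
  vertices.\<close>

definition kernel_endo :: "(nat set \<Rightarrow> nat set \<Rightarrow> complex) \<Rightarrow> endo" where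
  "kernel_endo f = lin_ext N (\<lambda>z p. if p \<in> verts N then f (D p) (D z) else 0)"

lemma kernel_endo_apply:
  "v \<in> V N \<Longrightarrow> kernel_endo f v
     = (\<lambda>p. if p \<in> verts N then \<Sum>z\<in>verts N. v z * f (D p) (D z) else 0)"
  by (auto simp: kernel_endo_def lin_ext_def fun_eq_iff)

lemma kernel_endo_in_V: "v \<in> V N \<Longrightarrow> kernel_endo f v \<in> V N"
  by (simp add: kernel_endo_apply) (simp add: V_def free_space_def)

lemma kernel_endo_extensional: "kernel_endo f \<in> extensional (V N)"
  by (simp add: kernel_endo_def lin_ext_def)

lemma kernel_endo_cong:
  assumes "\<And>Y Z. \<lbrakk>Y \<subseteq> {1..N}; Z \<subseteq> {1..N}\<rbrakk> \<Longrightarrow> g Y Z = f Y Z"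
  shows "kernel_endo g = kernel_endo f"
  unfolding kernel_endo_def by (intro lin_ext_cong) (simp only: assms D_subset)

lemma end_add_kernel:
  "end_add N (kernel_endo f) (kernel_endo g) = kernel_endo (\<lambda>Y Z. f Y Z + g Y Z)"
  by (rule extensionalityI[OF _ kernel_endo_extensional])
    (auto simp: end_add_def kernel_endo_apply fun_eq_iff distrib_left sum.distrib)

lemma end_scale_kernel: "end_scale N c (kernel_endo f) = kernel_endo (\<lambda>Y Z. c * f Y Z)"
  by (rule extensionalityI[OF _ kernel_endo_extensional])
    (auto simp: end_scale_def kernel_endo_apply fun_eq_iff sum_distrib_left mult_ac)

lemma end_mult_kernel:
  "end_mult N (kernel_endo f) (kernel_endo g)
    = kernel_endo (\<lambda>Y Z. \<Sum>W\<in>Pow {1..N}. f Y W * g W Z)"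
proof (rule extensionalityI[OF _ kernel_endo_extensional])
  fix v assume v: "v \<in> V N"
  have "(\<Sum>z\<in>verts N. (\<Sum>w\<in>verts N. v w * g (D z) (D w)) * f (D p) (D z))
      = (\<Sum>w\<in>verts N. v w * (\<Sum>X\<in>Pow {1..N}. f (D p) X * g X (D w)))" for p
  proof -
    have "(\<Sum>z\<in>verts N. (\<Sum>w\<in>verts N. v w * g (D z) (D w)) * f (D p) (D z))
        = (\<Sum>w\<in>verts N. v w * (\<Sum>z\<in>verts N. f (D p) (D z) * g (D z) (D w)))"
      unfolding sum_distrib_left sum_distrib_right
      by (subst sum.swap) (simp add: mult_ac)
    also have "\<dots> = (\<Sum>w\<in>verts N. v w * (\<Sum>X\<in>Pow {1..N}. f (D p) X * g X (D w)))"
      by (simp only: sum.reindex_bij_betw[OF bij_D, of "\<lambda>X. f (D p) X * g X (D _)"])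
    finally show ?thesis .
  qed
  moreover have "end_mult N (kernel_endo f) (kernel_endo g) v
      = (\<lambda>p. if p \<in> verts N then \<Sum>z\<in>verts N. kernel_endo g v z * f (D p) (D z) else 0)"
    using v by (simp add: end_mult_def compose_def kernel_endo_apply[OF kernel_endo_in_V])
  ultimately show "end_mult N (kernel_endo f) (kernel_endo g) v
      = kernel_endo (\<lambda>Y Z. \<Sum>W\<in>Pow {1..N}. f Y W * g W Z) v"
    by (simp only: kernel_endo_apply[OF v] if_True cong: sum.cong)
qed (auto simp: end_mult_def)

lemma end_one_kernel: "end_one N = kernel_endo (\<lambda>Y Z. of_bool (Y = Z))"
proof (rule extensionalityI[OF _ kernel_endo_extensional])
  fix v assume v: "v \<in> V N"
  have "v p = (if p \<in> verts N then \<Sum>z\<in>verts N. v z * of_bool (D p = D z) else 0)" for p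
  proof (cases "p \<in> verts N")
    case True
    then have "(\<Sum>z\<in>verts N. v z * of_bool (D p = D z)) = (\<Sum>z\<in>verts N. if p = z then v z else 0)"
      by (intro sum.cong) (auto simp: D_eq_iff)
    with True show ?thesis by (simp add: sum.delta')
  next
    case False
    with v show ?thesis by (simp add: V_def free_space_def)
  qed
  with v show "end_one N v = kernel_endo (\<lambda>Y Z. of_bool (Y = Z)) v"
    by (auto simp: end_one_def kernel_endo_apply)
qed (auto simp: end_one_def)

lemma adj_map_kernel: "adj_map N = kernel_endo (\<lambda>Y Z. of_bool (card (sym_diff Y Z) = 1))"
  unfolding adj_map_def kernel_endo_def
proof (rule lin_ext_cong)
  fix x p assume x: "x \<in> verts N"
  have fin: "finite {y. (x, y) \<in> adj N}"
    by (rule finite_subset[OF _ finite_verts[of N]]) (auto simp: adj_def)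
  have "(\<Sum>y | (x, y) \<in> adj N. basis_vec y p) = (if (x, p) \<in> adj N then 1 else 0)"
    using fin by (simp add: basis_vec_def sum.delta')
  also have "\<dots> = (if p \<in> verts N then of_bool (card (sym_diff (D p) (D x)) = 1) else 0)"
    using adj_iff[OF x, of p] by (auto simp: adj_def Un_commute)
  finally show "(\<Sum>y | (x, y) \<in> adj N. basis_vec y p)
      = (if p \<in> verts N then of_bool (card (sym_diff (D p) (D x)) = 1) else 0)" .
qed

lemma dual_adj_map_kernel:
  "dual_adj_map N \<kappa>
    = kernel_endo (\<lambda>Y Z. of_bool (Y = Z) * (of_nat (card {1..N}) - 2 * of_nat (card Y)))"
  unfolding dual_adj_map_def kernel_endo_def
proof (rule lin_ext_cong)
  fix x p assume x: "x \<in> verts N"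
  have "diff_set N x \<kappa> = D x" by (auto simp: D_def diff_set_def)
  then have "path_dist N x \<kappa> = card (D x)" using path_dist_eq_card[OF x base] by simp
  then show "(of_nat N - 2 * of_nat (path_dist N x \<kappa>)) * basis_vec x p
      = (if p \<in> verts N
         then of_bool (D p = D x) * (of_nat (card {1..N}) - 2 * of_nat (card (D p))) else 0)"
    using x by (auto simp: basis_vec_def D_eq_iff)
qed

text \<open>Since \<open>S\<close> is arbitrary, a kernel shown to lie in every such algebra yields
  an element of the intersection defining T.\<close>

lemma kernel_algebra_subalgebra:
  assumes "subalgebra_End N S" "adj_map N \<in> S" "dual_adj_map N \<kappa> \<in> S"
  shows "kernel_algebra {1..N} {f. kernel_endo f \<in> S}"
proof
  fix f g :: "nat set \<Rightarrow> nat set \<Rightarrow> complex"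
  assume "f \<in> {f. kernel_endo f \<in> S}" "\<And>Y Z. \<lbrakk>Y \<subseteq> {1..N}; Z \<subseteq> {1..N}\<rbrakk> \<Longrightarrow> g Y Z = f Y Z"
  then show "g \<in> {f. kernel_endo f \<in> S}"
    using kernel_endo_cong[of g f] by simp
qed (use assms in \<open>simp_all only: mem_Collect_eq subalgebra_End_def end_add_kernel[symmetric]
    end_scale_kernel[symmetric] end_mult_kernel[symmetric] end_one_kernel[symmetric]
    adj_map_kernel[symmetric] dual_adj_map_kernel[symmetric] finite_atLeastAtMost\<close>)

section \<open>Automorphisms of the graph from maps of subsets\<close>

lemma automorphism_of_set_map:
  assumes h: "bij_betw h (Pow {1..N}) (Pow {1..N})"
    and "\<And>Y Z. \<lbrakk>Y \<subseteq> {1..N}; Z \<subseteq> {1..N}\<rbrakk>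
      \<Longrightarrow> card (sym_diff (h Y) (h Z)) = card (sym_diff Y Z)"
  shows "(\<lambda>x\<in>verts N. W (h (D x))) \<in> aut_group N"
proof -
  have h_sub: "h (D x) \<subseteq> {1..N}" for x
    using bij_betwE[OF h] D_subset by auto
  have "bij_betw (W \<circ> (h \<circ> D)) (verts N) (verts N)"
    by (intro bij_betw_trans[OF _ bij_W] bij_betw_trans[OF bij_D h])
  then have "bij_betw (\<lambda>x\<in>verts N. W (h (D x))) (verts N) (verts N)"
    by (rule bij_betw_cong[THEN iffD1, rotated]) simp
  moreover have "(W (h (D x)), W (h (D y))) \<in> adj N \<longleftrightarrow> (x, y) \<in> adj N"
    if "x \<in> verts N" "y \<in> verts N" for x y
    using that assms(2)[OF D_subset D_subset, of x y]
    by (simp only: adj_iff W_in_verts D_W h_sub)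
  ultimately show ?thesis unfolding aut_group_def by simp
qed

text \<open>These automorphisms fix \<kappa>, because the image of the empty set is empty.\<close>

lemma permutation_automorphism:
  assumes \<pi>: "bij_betw \<pi> {1..N} {1..N}"
  shows "(\<lambda>x\<in>verts N. W (\<pi> ` D x)) \<in> aut_group N"
proof (rule automorphism_of_set_map)
  show "bij_betw ((`) \<pi>) (Pow {1..N}) (Pow {1..N})"
    using bij_betw_Pow[OF \<pi>] .
next
  fix Y Z assume YZ: "Y \<subseteq> {1..N}" "Z \<subseteq> {1..N}"
  have inj: "inj_on \<pi> {1..N}" using \<pi> by (rule bij_betw_imp_inj_on)
  have "sym_diff (\<pi> ` Y) (\<pi> ` Z) = \<pi> ` sym_diff Y Z"
    using YZ inj_on_image_set_diff[OF inj, of Y Z] inj_on_image_set_diff[OF inj, of Z Y]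
    by (auto simp: image_Un)
  moreover have "inj_on \<pi> (sym_diff Y Z)"
    using YZ by (intro inj_on_subset[OF inj]) auto
  ultimately show "card (sym_diff (\<pi> ` Y) (\<pi> ` Z)) = card (sym_diff Y Z)"
    by (simp add: card_image)
qed

text \<open>Taking \<open>F\<close> to be \<open>D x\<close> sends \<open>x\<close> to \<kappa>,
  which gives transitivity on vertices.\<close>

lemma translation_automorphism:
  assumes F: "F \<subseteq> {1..N}"
  shows "(\<lambda>x\<in>verts N. W (sym_diff (D x) F)) \<in> aut_group N"
proof (rule automorphism_of_set_map)
  show "bij_betw (\<lambda>Y. sym_diff Y F) (Pow {1..N}) (Pow {1..N})"
    by (rule bij_betw_byWitness[where f' = "\<lambda>Y. sym_diff Y F"]) (use F in auto)
next
  fix Y Z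
  show "card (sym_diff (sym_diff Y F) (sym_diff Z F)) = card (sym_diff Y Z)"
    by (rule arg_cong[where f = card]) auto
qed

end

section \<open>Invariant tensors\<close>

lemma act_V_basis_vec:
  assumes "x \<in> verts N"
  shows "act_V N g (basis_vec x) = basis_vec (g x)"
proof
  fix p
  have "act_V N g (basis_vec x) p = (\<Sum>w\<in>verts N. if w = x then basis_vec (g x) p else 0)"
    unfolding act_V_def by (intro sum.cong) (auto simp: basis_vec_def)
  with assms show "act_V N g (basis_vec x) p = basis_vec (g x) p" by simp
qed

text \<open>By injectivity of \<open>g\<close>, only the triple (x, y, z) contributes to the
  coefficient of the transformed tensor at its image; invariance of \<open>t\<close> then compares
  the two coefficients.\<close>

lemma Fix_G_invariant:
  assumes t: "t \<in> Fix_G N" and g: "g \<in> aut_group N"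
    and xyz: "x \<in> verts N" "y \<in> verts N" "z \<in> verts N"
  shows "t (g x, g y, g z) = t (x, y, z)"
proof -
  have inj: "g a = g b \<longleftrightarrow> a = b" if "a \<in> verts N" "b \<in> verts N" for a b
    using g that by (auto simp: aut_group_def bij_betw_def inj_on_def)
  have fin: "finite (triples N)" by (simp add: triples_def)
  have "t (g x, g y, g z) = act_V3 N g t (g x, g y, g z)"
    using t g by (simp add: Fix_G_def)
  also have "\<dots> = (\<Sum>q\<in>triples N. if q = (x, y, z) then t (x, y, z) else 0)"
    unfolding act_V3_def
  proof (rule sum.cong[OF refl])
    fix q assume "q \<in> triples N"
    then obtain a b c where q: "q = (a, b, c)" "a \<in> verts N" "b \<in> verts N" "c \<in> verts N"
      by (auto simp: triples_def)
    then show "(case q of (a, b, c) \<Rightarrow> t (a, b, c) * tensor3 (act_V N g (basis_vec a))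
          (act_V N g (basis_vec b)) (act_V N g (basis_vec c)) (g x, g y, g z))
        = (if q = (x, y, z) then t (x, y, z) else 0)"
      using xyz by (simp add: act_V_basis_vec tensor3_basis_vec)
        (auto simp: basis_vec_def inj)
  qed
  also have "\<dots> = t (x, y, z)"
    using xyz fin by (simp add: triples_def)
  finally show ?thesis .
qed

lemma aut_group_bij: "g \<in> aut_group N \<Longrightarrow> bij_betw g (verts N) (verts N)"
  by (simp add: aut_group_def)

context based_hypercube
begin

text \<open>Only basis tensors with first factor \<kappa> survive, so the matrix of the image is the
  slice of \<open>t\<close> at \<kappa>, scaled by 2^(N/2).\<close>

lemma eps_apply:
  assumes v: "v \<in> V N"
  shows "eps N \<kappa> t v = (\<lambda>p. if p \<in> verts N
    then \<Sum>z\<in>verts N. v z * (complex_of_real (2 powr (real N / 2)) * t (\<kappa>, p, z)) else 0)"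
proof
  fix p
  let ?c = "complex_of_real (2 powr (real N / 2))"
  have "eps N \<kappa> t v p = (\<Sum>x\<in>verts N. \<Sum>y\<in>verts N. \<Sum>z\<in>verts N.
      t (x, y, z) * eps_basis N \<kappa> x y z v p)"
    using v by (simp add: eps_def triples_def sum.cartesian_product)
  also have "\<dots> = (\<Sum>x\<in>verts N. if x = \<kappa> then \<Sum>y\<in>verts N. \<Sum>z\<in>verts N.
      if y = p then v z * (?c * t (\<kappa>, p, z)) else 0 else 0)"
  proof (intro sum.cong refl)
    fix x assume "x \<in> verts N"
    show "(\<Sum>y\<in>verts N. \<Sum>z\<in>verts N. t (x, y, z) * eps_basis N \<kappa> x y z v p)
        = (if x = \<kappa> then \<Sum>y\<in>verts N. \<Sum>z\<in>verts N.
            if y = p then v z * (?c * t (\<kappa>, p, z)) else 0 else 0)"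
    proof (cases "x = \<kappa>")
      case True
      then show ?thesis
        using v by (auto simp: eps_basis_def end_scale_def mat_unit_apply basis_vec_def
            intro!: sum.cong)
    next
      case False
      then show ?thesis using v by (simp add: eps_basis_def end_zero_def)
    qed
  qed
  also have "\<dots> = (\<Sum>y\<in>verts N. \<Sum>z\<in>verts N. if y = p then v z * (?c * t (\<kappa>, p, z)) else 0)"
    using base by simp
  also have "\<dots> = (\<Sum>y\<in>verts N. if y = p then \<Sum>z\<in>verts N. v z * (?c * t (\<kappa>, p, z)) else 0)"
    by (intro sum.cong) auto
  also have "\<dots> = (if p \<in> verts N then \<Sum>z\<in>verts N. v z * (?c * t (\<kappa>, p, z)) else 0)"
    by simp
  finally show "eps N \<kappa> t v p
      = (if p \<in> verts N then \<Sum>z\<in>verts N. v z * (?c * t (\<kappa>, p, z)) else 0)" .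
qed

lemma eps_kernel:
  "eps N \<kappa> t
    = kernel_endo (\<lambda>Y Z. complex_of_real (2 powr (real N / 2)) * t (\<kappa>, W Y, W Z))"
proof (rule extensionalityI[OF _ kernel_endo_extensional])
  show "eps N \<kappa> t \<in> extensional (V N)" by (simp add: eps_def)
qed (auto simp: eps_apply kernel_endo_apply W_D fun_eq_iff)

text \<open>Equal cardinalities provide a coordinate permutation taking one pair of subsets to the
  other; the automorphism it induces fixes \<kappa> and hence preserves the slice there.\<close>

lemma Fix_G_cards_invariant:
  assumes t: "t \<in> Fix_G N"
    and sub: "Y \<subseteq> {1..N}" "Z \<subseteq> {1..N}" "Y' \<subseteq> {1..N}" "Z' \<subseteq> {1..N}"
    and cards: "card Y = card Y'" "card Z = card Z'" "card (Y \<inter> Z) = card (Y' \<inter> Z')"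
  shows "t (\<kappa>, W Y, W Z) = t (\<kappa>, W Y', W Z')"
proof -
  obtain \<pi> where \<pi>: "bij_betw \<pi> {1..N} {1..N}" "\<pi> ` Y = Y'" "\<pi> ` Z = Z'"
    using ex_bij_betw_two_subsets[OF finite_atLeastAtMost sub cards] by blast
  define g where "g = (\<lambda>x\<in>verts N. W (\<pi> ` D x))"
  have "t (g \<kappa>, g (W Y), g (W Z)) = t (\<kappa>, W Y, W Z)"
    unfolding g_def
    by (intro Fix_G_invariant[OF t] permutation_automorphism \<pi> base W_in_verts)
  moreover have "D \<kappa> = {}" by (simp add: D_def diff_set_def)
  ultimately show ?thesis
    using \<pi> sub base by (simp add: g_def W_in_verts D_W W_empty)
qed

lemma eps_in_subconst_alg:
  assumes t: "t \<in> Fix_G N"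
  shows "eps N \<kappa> t \<in> subconst_alg N \<kappa>"
  unfolding subconst_alg_def
proof (rule InterI, clarify)
  fix S assume S: "subalgebra_End N S" "adj_map N \<in> S" "dual_adj_map N \<kappa> \<in> S"
  interpret kernel_algebra "{1..N}" "{f. kernel_endo f \<in> S}"
    by (rule kernel_algebra_subalgebra[OF S])
  have "(\<lambda>Y Z. complex_of_real (2 powr (real N / 2)) * t (\<kappa>, W Y, W Z))
      \<in> {f. kernel_endo f \<in> S}"
    by (intro scale mem_if_cards_invariant Fix_G_cards_invariant[OF t])
  then show "eps N \<kappa> t \<in> S" by (simp add: eps_kernel)
qed

lemma eps_entry:
  assumes "y \<in> verts N" "z \<in> verts N"
  shows "eps N \<kappa> t (basis_vec z) y = complex_of_real (2 powr (real N / 2)) * t (\<kappa>, y, z)"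
proof -
  have "basis_vec z w * c = (if w = z then c else 0)" for w c
    by (simp add: basis_vec_def)
  with assms show ?thesis by (simp add: eps_apply basis_vec_in_V)
qed

text \<open>Translation by \<open>D x\<close> carries \<open>x\<close> to \<kappa> and permutes the
  vertices in the other two positions, so the sums agree after reindexing.\<close>

lemma slice_form_eq:
  assumes uv: "u \<in> Fix_G N" "v \<in> Fix_G N" and x: "x \<in> verts N"
  shows "(\<Sum>y\<in>verts N. \<Sum>z\<in>verts N. u (x, y, z) * cnj (v (x, y, z)))
    = (\<Sum>y\<in>verts N. \<Sum>z\<in>verts N. u (\<kappa>, y, z) * cnj (v (\<kappa>, y, z)))"
proof -
  define g where "g = (\<lambda>w\<in>verts N. W (sym_diff (D w) (D x)))"
  have g: "g \<in> aut_group N"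
    unfolding g_def by (rule translation_automorphism[OF D_subset])
  note bij = aut_group_bij[OF g]
  have gx: "g x = \<kappa>" using x by (simp add: g_def W_empty)
  have "(\<Sum>y\<in>verts N. \<Sum>z\<in>verts N. u (x, y, z) * cnj (v (x, y, z)))
      = (\<Sum>y\<in>verts N. \<Sum>z\<in>verts N. u (g x, g y, g z) * cnj (v (g x, g y, g z)))"
    using x by (intro sum.cong refl) (simp add: Fix_G_invariant[OF uv(1) g] Fix_G_invariant[OF uv(2) g])
  also have "\<dots> = (\<Sum>y\<in>verts N. \<Sum>z\<in>verts N. u (\<kappa>, g y, z) * cnj (v (\<kappa>, g y, z)))"
    unfolding gx by (intro sum.cong refl sum.reindex_bij_betw[OF bij])
  also have "\<dots> = (\<Sum>y\<in>verts N. \<Sum>z\<in>verts N. u (\<kappa>, y, z) * cnj (v (\<kappa>, y, z)))"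
    by (rule sum.reindex_bij_betw[OF bij])
  finally show ?thesis .
qed

lemma eps_isometry:
  assumes uv: "u \<in> Fix_G N" "v \<in> Fix_G N"
  shows "herm_form (triples N) u v = end_form N (eps N \<kappa> u) (eps N \<kappa> v)"
proof -
  let ?c = "complex_of_real (2 powr (real N / 2))"
  let ?s = "\<Sum>y\<in>verts N. \<Sum>z\<in>verts N. u (\<kappa>, y, z) * cnj (v (\<kappa>, y, z))"
  have card: "card (verts N) = 2 ^ N"
    using bij_betw_same_card[OF bij_D] by (simp add: card_Pow)
  have "(2 powr (real N / 2)) * (2 powr (real N / 2)) = (2 ^ N :: real)"
    by (simp add: powr_add[symmetric] powr_realpow)
  \<comment> \<open>The square of the scalar equals the number of vertices, hence the number of
    equal slices.\<close>
  then have c: "?c * ?c = 2 ^ N"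
    by (metis of_real_mult of_real_numeral of_real_power)
  have "herm_form (triples N) u v
      = (\<Sum>x\<in>verts N. \<Sum>y\<in>verts N. \<Sum>z\<in>verts N. u (x, y, z) * cnj (v (x, y, z)))"
    by (simp add: herm_form_def triples_def sum.cartesian_product)
  also have "\<dots> = (\<Sum>x\<in>verts N. ?s)"
    by (intro sum.cong refl slice_form_eq uv)
  also have "\<dots> = (?c * ?c) * ?s"
    by (simp add: card c)
  \<comment> \<open>The scalar is real, so conjugation leaves it unchanged and one copy can go into
    each argument of the form.\<close>
  also have "\<dots> = (\<Sum>y\<in>verts N. \<Sum>z\<in>verts N. (?c * u (\<kappa>, y, z)) * cnj (?c * v (\<kappa>, y, z)))"
    by (simp add: sum_distrib_left mult_ac)
  also have "\<dots> = end_form N (eps N \<kappa> u) (eps N \<kappa> v)"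
    unfolding end_form_def by (intro sum.cong refl) (simp add: eps_entry)
  finally show ?thesis .
qed

end

theorem theorem18p18:
  fixes N :: nat and \<kappa> :: vertex
  assumes "\<kappa> \<in> verts N"
  shows "eps N \<kappa> ` Fix_G N \<subseteq> subconst_alg N \<kappa> \<and>
    (\<forall>u\<in>Fix_G N. \<forall>v\<in>Fix_G N.
       herm_form (triples N) u v = end_form N (eps N \<kappa> u) (eps N \<kappa> v))"
proof -
  interpret based_hypercube N \<kappa> by unfold_locales (rule assms)
  show ?thesis using eps_in_subconst_alg eps_isometry by blast
qed

end
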